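(* Let $k \geq 2$ be an integer, let $K_2$ be the graph consisting of two vertices joined by a single edge, and let $D = D_k(K_2)$ be its order-$k$ Steiner distance hypermatrix. Then $$\det(D) = (-1)^{k-1} \prod_{j=0}^{k-2} \left( \left( 1 + e^{\frac{2\pi i j}{k-1}} \right)^{k-1} - 1 \right).$$ That is, $(-1)^{k-1}\det(D)$ equals Wendt's determinant $W_{k-1}$.
   Context: Steiner distance hypermatrix of $K_2$: $D_k(K_2)$ is the order-$k$, dimension-$2$ array indexed by $V(K_2)^k$ whose $(v_1,\ldots,v_k)$ entry is the Steiner distance of $\{v_1,\ldots,v_k\}$, i.e. the least number of edges in a connected subgraph containing these vertices. Thus the entry is $0$ if $v_1=\cdots=v_k$ and $1$ otherwise. Hyperdeterminant (Qi's symmetric hyperdeterminant): for a symmetric order-$k$, dimension-$n$ hypermatrix $M = (m_{i_1 \cdots i_k})$ over $\mathbb{C}$, $\det(M)$ is the (multivariate, Macaulay) resultant of the $n$ homogeneous polynomials of degree $k-1$ $$F_i(x) = \sum_{i_2,\ldots,i_k=1}^n m_{i i_2 \cdots i_k}\, x_{i_2}\cdots x_{i_k}, \qquad i = 1,\ldots,n,$$ normalized so that the resultant of $x_1^{k-1},\ldots,x_n^{k-1}$ is $1$. For $n=2$ this is the $2(k-1)\times 2(k-1)$ Sylvester determinant of $F_1, F_2$: its first $k-1$ rows are the successive right shifts of the coefficient row of $F_1$ (coefficients of $x_1^{k-1}, x_1^{k-2}x_2, \ldots, x_2^{k-1}$ in order), followed by $k-1$ rows that are the successive right shifts of the coefficient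 row of $F_2$. Wendt's determinant: $W_m = \prod_{j=0}^{m-1} \left( \left(1+e^{2\pi i j/m}\right)^m - 1 \right)$ for $m \geq 1$. Here $i=\sqrt{-1}$ in the exponentials. *)

theory Defs
  imports
    "Subresultants.Resultant_Prelim"
    "HOL-Library.Poly_Mapping"
    Complex_Main
begin

section \<open>Graphs and Steiner distance\<close>

text \<open>A graph is a pair of a vertex set and a set of edges, each edge being a two-element set
  of vertices.\<close>

type_synonym 'v graph = "'v set \<times> 'v set set"

definition is_graph :: "'v graph \<Rightarrow> bool" where
  "is_graph G \<longleftrightarrow> (\<forall>e \<in> snd G. e \<subseteq> fst G \<and> card e = 2)"

definition is_subgraph :: "'v graph \<Rightarrow> 'v graph \<Rightarrow> bool" where
  "is_subgraph H G \<longleftrightarrow> is_graph H \<and> fst H \<subseteq> fst G \<and> snd H \<subseteq> snd G"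

definition connected_graph :: "'v graph \<Rightarrow> bool" where
  "connected_graph H \<longleftrightarrow> fst H \<noteq> {} \<and>
     (\<forall>u \<in> fst H. \<forall>v \<in> fst H. (u, v) \<in> {(x, y). {x, y} \<in> snd H}\<^sup>*)"

text \<open>Finiteness of the edge set is required because \<^const>\<open>card\<close> is 0 on infinite sets.\<close>

definition steiner_dist :: "'v graph \<Rightarrow> 'v set \<Rightarrow> nat" where
  "steiner_dist G S = (LEAST n. \<exists>H. is_subgraph H G \<and> connected_graph H \<and> S \<subseteq> fst H \<and>
     finite (snd H) \<and> card (snd H) = n)"

text \<open>The vertices of $K_2$ are named 1 and 2 so that they can serve directly as indices.\<close>

definition K2 :: "nat graph" where
  "K2 = ({1, 2}, {{1, 2}})"


section \<open>Hypermatrices\<close>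

text \<open>A hypermatrix of order $k$ with index set $I$ is a function on lists; only its values on
  lists of length $k$ over $I$ matter.\<close>

definition steiner_hypermatrix :: "nat \<Rightarrow> 'v graph \<Rightarrow> 'v list \<Rightarrow> complex" where
  "steiner_hypermatrix k G vs =
     (if length vs = k \<and> set vs \<subseteq> fst G then of_nat (steiner_dist G (set vs)) else 0)"

text \<open>Multivariate polynomials are finitely supported maps from monomials (finitely supported
  exponent functions) to coefficients.\<close>

type_synonym mpolynomial = "(nat \<Rightarrow>\<^sub>0 nat) \<Rightarrow>\<^sub>0 complex"

definition mconst :: "complex \<Rightarrow> mpolynomial" where
  "mconst c = Poly_Mapping.single 0 c"

definition mvar :: "nat \<Rightarrow> mpolynomial" where
  "mvar i = Poly_Mapping.single (Poly_Mapping.single i 1) 1"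

text \<open>The form $F_i$ of degree $k-1$ attached to a hypermatrix of order $k$ and dimension $n$ with
  index set $\{1,\ldots,n\}$.\<close>

definition hyper_form :: "nat \<Rightarrow> nat \<Rightarrow> (nat list \<Rightarrow> complex) \<Rightarrow> nat \<Rightarrow> mpolynomial" where
  "hyper_form k n M i =
     (\<Sum>js \<in> {js. length js = k - 1 \<and> set js \<subseteq> {1..n}}.
        mconst (M (i # js)) * (\<Prod>j \<leftarrow> js. mvar j))"

text \<open>The resultant of two binary forms of degree $d$ in $x_1, x_2$.  Setting $x_2 = 1$ turns them
  into univariate polynomials whose coefficient at degree $j$ is that of $x_1^j x_2^{d-j}$.  The
  Sylvester matrix is taken for the formal degrees $(d,d)$, since the coefficient of $x_1^d$ may
  vanish; \<^const>\<open>sylvester_mat_sub\<close> lists the coefficients in each row by decreasing power of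
  $x_1$.\<close>

definition dehomogenize :: "nat \<Rightarrow> mpolynomial \<Rightarrow> complex poly" where
  "dehomogenize d F =
     (\<Sum>j \<le> d. monom (Poly_Mapping.lookup F
        (Poly_Mapping.single 1 j + Poly_Mapping.single 2 (d - j))) j)"

definition binary_resultant :: "nat \<Rightarrow> mpolynomial \<Rightarrow> mpolynomial \<Rightarrow> complex" where
  "binary_resultant d F G = det (sylvester_mat_sub d d (dehomogenize d F) (dehomogenize d G))"

text \<open>Qi's hyperdeterminant in dimension 2, where the multivariate resultant is the one of two
  binary forms.\<close>

definition hyperdet2 :: "nat \<Rightarrow> (nat list \<Rightarrow> complex) \<Rightarrow> complex" where
  "hyperdet2 k M = binary_resultant (k - 1) (hyper_form k 2 M 1) (hyper_form k 2 M 2)"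


section \<open>Wendt's determinant\<close>

definition wendt :: "nat \<Rightarrow> complex" where
  "wendt m = (\<Prod>j = 0..<m. ((1 + exp (2 * of_real pi * \<i> * of_nat j / of_nat m)) ^ m - 1))"

end

(* Put d = k - 1. The two forms dehomogenize to f = (X + 1)^d - X^d and g = (X + 1)^d - 1, so
   g = f + X^d - 1. With the upper half of the Sylvester matrix split into square blocks A and B,
   the lower half is therefore (A + 1 | B - 1), and subtracting the upper rows turns it into (1 | -1).
   Hence the determinant is (-1)^d det (A + B). The matrix A + B holds the coefficients of f wrapped
   around modulo d; it is diagonalised by the Vandermonde matrix of the d-th roots of unity z, with
   eigenvalues f(z) = (1 + z)^d - 1. *)

theory Submission
  imports Defs
begin

section \<open>Determinants of Vandermonde, wrapped Toeplitz and Sylvester matrices\<close>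

lemma poly_eq_sum_atMost:
  fixes p :: "'a::comm_semiring_1 poly"
  assumes "degree p \<le> n"
  shows "poly p x = (\<Sum>m\<le>n. coeff p m * x ^ m)"
proof -
  have "(\<Sum>m\<le>degree p. coeff p m * x ^ m) = (\<Sum>m\<le>n. coeff p m * x ^ m)"
    using assms by (intro sum.mono_neutral_left) (auto simp: coeff_eq_0)
  thus ?thesis by (simp add: poly_altdef)
qed

text \<open>A kernel vector of the transpose, read as a coefficient list, would be a nonzero
  polynomial of degree below \<open>n\<close> with the \<open>n\<close> distinct roots
  \<open>z l\<close>. The powers decrease with the row index to match the order of coefficients in a
  Sylvester row.\<close>

lemma det_vandermonde_nonzero:
  fixes z :: "nat \<Rightarrow> 'a::field"
  assumes inj: "inj_on z {..<n}"
  shows "det (mat n n (\<lambda>(j, l). z l ^ (n - 1 - j))) \<noteq> 0"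
proof
  let ?V = "mat n n (\<lambda>(j, l). z l ^ (n - 1 - j))"
  let ?W = "mat n n (\<lambda>(l, j). z l ^ (n - 1 - j))"
  assume "det ?V = 0"
  moreover have "transpose_mat ?V = ?W" by (rule eq_matI) auto
  moreover have "det (transpose_mat ?V) = det ?V" by (rule det_transpose) auto
  ultimately have "det ?W = 0" by simp
  moreover have "?W \<in> carrier_mat n n" by simp
  ultimately obtain v where v: "v \<in> carrier_vec n" "v \<noteq> 0\<^sub>v n" "?W *\<^sub>v v = 0\<^sub>v n"
    using det_0_iff_vec_prod_zero_field by blast
  define p where "p = (\<Sum>j<n. monom (v $ j) (n - 1 - j))"
  have coeff: "coeff p (n - 1 - i) = v $ i" if "i < n" for i
  proof -
    have "coeff p (n - 1 - i) = (\<Sum>j<n. if n - 1 - j = n - 1 - i then v $ j else 0)"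
      by (simp add: p_def coeff_sum)
    also have "\<dots> = (\<Sum>j<n. if j = i then v $ j else 0)"
      using that by (intro sum.cong) auto
    finally show ?thesis using that by simp
  qed
  obtain i where i: "i < n" "v $ i \<noteq> 0" using v(1,2) by (auto simp: vec_eq_iff)
  hence p0: "p \<noteq> 0" using coeff[of i] by auto
  have "degree p \<le> n - 1" unfolding p_def
    by (intro degree_sum_le) (auto intro: order.trans[OF degree_monom_le])
  \<comment> \<open>The index \<open>i\<close> also witnesses \<open>n > 0\<close>, without which
    \<open>n - 1\<close> would truncate and the strict bound would fail.\<close>
  hence deg: "degree p < n" using i(1) by linarith
  have root: "poly p (z l) = 0" if "l < n" for l
  proof -
    have "poly p (z l) = (\<Sum>j<n. v $ j * z l ^ (n - 1 - j))"
      by (simp add: p_def poly_sum poly_monom)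
    also have "\<dots> = (?W *\<^sub>v v) $ l"
      using that v(1) by (auto simp: scalar_prod_def atLeast0LessThan mult.commute intro!: sum.cong)
    also have "\<dots> = 0" using that by (simp only: v(3) index_zero_vec)
    finally show ?thesis .
  qed
  have "n = card (z ` {..<n})" using inj by (simp add: card_image)
  also have "\<dots> \<le> card {x. poly p x = 0}"
    using root by (intro card_mono poly_roots_finite[OF p0]) auto
  also have "\<dots> \<le> degree p" by (rule card_poly_roots_bound[OF p0])
  finally show False using deg by simp
qed

text \<open>Row \<open>i\<close> of the sum lists, by decreasing power, the coefficients of
  X^(d-1-i) f reduced modulo X^d - 1. Evaluating it at a root z of X^d - 1 gives z^(d-1-i) f(z), so
  the column of powers of z is an eigenvector with eigenvalue f(z).\<close>

lemma det_wrapped_toeplitz: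
  fixes f :: "'a::field poly" and z :: "nat \<Rightarrow> 'a"
  assumes deg: "degree f \<le> d" and inj: "inj_on z {..<d}" and z: "\<And>l. l < d \<Longrightarrow> z l ^ d = 1"
  shows "det (mat d d (\<lambda>(i, j). if i \<le> j then coeff f (d + i - j) else 0) +
              mat d d (\<lambda>(i, j). if j \<le> i then coeff f (i - j) else 0)) = (\<Prod>l<d. poly f (z l))"
    (is "det (?A + ?B) = _")
proof -
  define V where "V = mat d d (\<lambda>(j, l). z l ^ (d - 1 - j))"
  define L where "L = mat d d (\<lambda>(i, l). if i = l then poly f (z l) else 0)"
  have V: "V \<in> carrier_mat d d" and L: "L \<in> carrier_mat d d" by (auto simp: V_def L_def)
  have C: "?A + ?B \<in> carrier_mat d d" by auto
  have entry: "(\<Sum>j<d. ((if i \<le> j then coeff f (d + i - j) else 0) +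
                   (if j \<le> i then coeff f (i - j) else 0)) * x ^ (d - 1 - j))
               = x ^ (d - 1 - i) * poly f x" (is "?lhs = _") if "i < d" "x ^ d = 1" for i and x :: 'a
  proof -
    let ?g = "\<lambda>m. coeff f m * x ^ (m + (d - 1 - i))"
    \<comment> \<open>The first block supplies the coefficients of index m > i. Their exponents m +
      (d - 1 - i) are at least d, and \<open>x ^ d = 1\<close> lowers them by d. The second block
      supplies m at most i, where nothing wraps. On the diagonal both contribute, with m = d and m =
      0.\<close>
    have "(\<Sum>j<d. (if i \<le> j then coeff f (d + i - j) else 0) * x ^ (d - 1 - j))
        = (\<Sum>j\<in>{i..<d}. coeff f (d + i - j) * x ^ (d - 1 - j))"
      using that by (intro sum.mono_neutral_cong_right) auto
    also have "\<dots> = sum ?g {i<..d}"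
    proof (rule sum.reindex_bij_witness[of _ "\<lambda>m. d + i - m" "\<lambda>j. d + i - j"])
      fix j assume j: "j \<in> {i..<d}"
      have e: "d + i - j + (d - 1 - i) = d + (d - 1 - j)" using j by auto
      thus "coeff f (d + i - j) * x ^ (d + i - j + (d - 1 - i)) = coeff f (d + i - j) * x ^ (d - 1 - j)"
        unfolding e power_add using that by simp
    qed (use that in auto)
    finally have upper: "(\<Sum>j<d. (if i \<le> j then coeff f (d + i - j) else 0) * x ^ (d - 1 - j))
        = sum ?g {i<..d}" .
    have "(\<Sum>j<d. (if j \<le> i then coeff f (i - j) else 0) * x ^ (d - 1 - j))
        = (\<Sum>j\<in>{..i}. coeff f (i - j) * x ^ (d - 1 - j))"
      using that by (intro sum.mono_neutral_cong_right) auto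
    also have "\<dots> = sum ?g {..i}"
    proof (rule sum.reindex_bij_witness[of _ "\<lambda>m. i - m" "\<lambda>j. i - j"])
      fix j assume j: "j \<in> {..i}"
      have "i - j + (d - 1 - i) = d - 1 - j" using j that by auto
      thus "coeff f (i - j) * x ^ (i - j + (d - 1 - i)) = coeff f (i - j) * x ^ (d - 1 - j)"
        by simp
    qed auto
    finally have lower: "(\<Sum>j<d. (if j \<le> i then coeff f (i - j) else 0) * x ^ (d - 1 - j))
        = sum ?g {..i}" .
    have "?lhs = sum ?g {i<..d} + sum ?g {..i}"
      by (simp only: distrib_right sum.distrib upper lower)
    also have "\<dots> = sum ?g ({i<..d} \<union> {..i})" by (rule sum.union_disjoint[symmetric]) auto
    also have "{i<..d} \<union> {..i} = {..d}" using that by auto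
    also have "sum ?g {..d} = x ^ (d - 1 - i) * poly f x"
      by (simp add: poly_eq_sum_atMost[OF deg] sum_distrib_left power_add mult_ac)
    finally show ?thesis .
  qed
  have "(?A + ?B) * V = V * L"
  proof (rule eq_matI)
    fix i l assume "i < dim_row (V * L)" "l < dim_col (V * L)"
    hence il: "i < d" "l < d" using V L by auto
    have "((?A + ?B) * V) $$ (i, l) = z l ^ (d - 1 - i) * poly f (z l)"
      unfolding entry[OF il(1) z[OF il(2)], symmetric]
      using il by (auto simp: V_def scalar_prod_def atLeast0LessThan intro!: sum.cong)
    also have "\<dots> = (V * L) $$ (i, l)"
      using il by (simp add: V_def L_def scalar_prod_def if_distrib sum.delta cong: if_cong)
    finally show "((?A + ?B) * V) $$ (i, l) = (V * L) $$ (i, l)" .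
  qed (auto simp: V_def L_def)
  hence "det (?A + ?B) * det V = det V * det L"
    unfolding det_mult[OF C V, symmetric] det_mult[OF V L, symmetric] by (rule arg_cong)
  moreover have "det V \<noteq> 0" unfolding V_def by (rule det_vandermonde_nonzero[OF inj])
  ultimately have "det (?A + ?B) = det L" by simp
  also have "det L = prod_list (diag_mat L)"
    by (rule det_upper_triangular[OF _ L]) (auto simp: L_def upper_triangular_def)
  also have "\<dots> = (\<Prod>l<d. poly f (z l))"
    by (simp add: prod_list_diag_prod L_def atLeast0LessThan)
  finally show ?thesis .
qed

lemma det_sylvester_add_roots_of_unity:
  fixes f :: "'a::field poly" and z :: "nat \<Rightarrow> 'a"
  assumes d: "d > 0" and deg: "degree f \<le> d"
    and inj: "inj_on z {..<d}" and z: "\<And>l. l < d \<Longrightarrow> z l ^ d = 1"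
  shows "det (sylvester_mat_sub d d f (f + monom 1 d - 1)) = (-1) ^ d * (\<Prod>l<d. poly f (z l))"
proof -
  define A where "A = mat d d (\<lambda>(i, j). if i \<le> j then coeff f (d + i - j) else 0)"
  define B where "B = mat d d (\<lambda>(i, j). if j \<le> i then coeff f (i - j) else 0)"
  have A: "A \<in> carrier_mat d d" and B: "B \<in> carrier_mat d d" by (auto simp: A_def B_def)
  let ?I = "1\<^sub>m d :: 'a mat" and ?O = "0\<^sub>m d d :: 'a mat"
  let ?P = "four_block_mat ?I ?O ?I ?I" and ?Q = "four_block_mat A B ?I (- ?I)"
  \<comment> \<open>For formal degree d the leading coefficient of a shifted row lies on the
    diagonal of the left block and the constant one on the diagonal of the right block. There the
    summands X^d and -1 add ?I and -?I.\<close>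
  have "sylvester_mat_sub d d f (f + monom 1 d - 1) = four_block_mat A B (A + ?I) (B - ?I)"
    using d deg
    by (intro eq_matI)
       (auto simp: sylvester_mat_sub_index A_def B_def coeff_eq_0 not_less not_le
             coeff_1 add.commute split: if_splits)
  \<comment> \<open>Left multiplication by the unipotent \<open>?P\<close> adds the upper block row
    to the lower one.\<close>
  also have "\<dots> = ?P * ?Q"
    using A B by (subst mult_four_block_mat[of _ d d _ d _ d _ _ d _ d])
      (auto simp: minus_add_uminus_mat)
  finally have "det (sylvester_mat_sub d d f (f + monom 1 d - 1)) = det ?P * det ?Q"
    using A B det_mult[of ?P "d + d" ?Q] by auto
  also have "det ?P = 1" by (subst det_four_block_mat_upper_right_zero[of _ d _ d]) auto
  \<comment> \<open>The lower blocks are the identity and its negative; they commute, so the 2x2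
    determinant formula holds blockwise.\<close>
  also have "det ?Q = det (A * (- ?I) - B * ?I)"
    using A B by (intro det_four_block_mat) auto
  also have "A * (- ?I) - B * ?I = (-1) \<cdot>\<^sub>m (A + B)"
    using A B by (intro eq_matI) auto
  also have "det \<dots> = (-1) ^ d * det (A + B)" using A B by simp
  also have "det (A + B) = (\<Prod>l<d. poly f (z l))"
    unfolding A_def B_def by (rule det_wrapped_toeplitz[OF deg inj z])
  finally show ?thesis by simp
qed

section \<open>From the forms of a hypermatrix to univariate polynomials\<close>

lemma prod_list_mvar:
  "(\<Prod>j\<leftarrow>js. mvar j) = Poly_Mapping.single (\<Sum>j\<leftarrow>js. Poly_Mapping.single j 1) 1"
  by (induction js) (auto simp: mvar_def mult_single)

lemma lookup_sum_list_single:
  "Poly_Mapping.lookup (\<Sum>j\<leftarrow>js. Poly_Mapping.single j (1::nat)) i = count_list js i"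
  by (induction js) (auto simp: lookup_add lookup_single when_def)

lemma count_list_one_two:
  assumes "set js \<subseteq> {1..2::nat}"
  shows "count_list js 1 + count_list js 2 = length js"
  using assms
proof (induction js)
  case (Cons a js)
  moreover have "a = 1 \<or> a = 2" using Cons.prems by auto
  ultimately show ?case by auto
qed simp

text \<open>The total degree is fixed, so the exponent of the first variable determines that of the
  second.\<close>

lemma monomial_eq_iff_count_list:
  assumes "set js \<subseteq> {1..2}" and "length js = d" and "m \<le> d"
  shows "(\<Sum>j\<leftarrow>js. Poly_Mapping.single j 1) =
           Poly_Mapping.single 1 m + Poly_Mapping.single 2 (d - m) \<longleftrightarrow> count_list js (1::nat) = m"
    (is "?s = ?t \<longleftrightarrow> _")
proof
  assume "?s = ?t"
  hence "Poly_Mapping.lookup ?s 1 = Poly_Mapping.lookup ?t 1" by simp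
  thus "count_list js 1 = m" by (simp only: lookup_sum_list_single) (simp add: lookup_add lookup_single)
next
  assume m: "count_list js 1 = m"
  show "?s = ?t"
  proof (rule poly_mapping_eqI)
    fix i
    have "i \<notin> set js" if "i \<noteq> 1" "i \<noteq> 2" using assms(1) that by fastforce
    hence "count_list js i = 0" if "i \<noteq> 1" "i \<noteq> 2" using that by (simp add: count_notin)
    thus "Poly_Mapping.lookup ?s i = Poly_Mapping.lookup ?t i"
      using m count_list_one_two[OF assms(1)] assms(2)
      by (simp only: lookup_sum_list_single) (auto simp: lookup_add lookup_single when_def)
  qed
qed

text \<open>Each index list contributes one monomial, and setting the second variable to 1 leaves
  the power counting the 1s. Keeping the sum over lists avoids collecting terms into binomial
  coefficients.\<close>

lemma dehomogenize_hyper_form: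
  "dehomogenize (k - 1) (hyper_form k 2 M i) =
     (\<Sum>js | set js \<subseteq> {1..2} \<and> length js = k - 1. monom (M (i # js)) (count_list js 1))"
proof (rule poly_eqI)
  fix m
  let ?d = "k - 1"
  let ?L = "{js. set js \<subseteq> {1..2::nat} \<and> length js = ?d}"
  let ?t = "\<lambda>j. Poly_Mapping.single 1 j + Poly_Mapping.single 2 (?d - j) :: nat \<Rightarrow>\<^sub>0 nat"
  have count: "count_list js 1 \<le> ?d" if "js \<in> ?L" for js
    using count_list_one_two[of js] that by auto
  have form: "hyper_form k 2 M i =
      (\<Sum>js\<in>?L. Poly_Mapping.single (\<Sum>j\<leftarrow>js. Poly_Mapping.single j 1) (M (i # js)))"
    by (auto simp: hyper_form_def prod_list_mvar mconst_def mult_single conj_commute intro!: sum.cong)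
  have "coeff (dehomogenize ?d (hyper_form k 2 M i)) m =
          (if m \<le> ?d then Poly_Mapping.lookup (hyper_form k 2 M i) (?t m) else 0)"
    by (simp add: dehomogenize_def coeff_sum)
  also have "\<dots> =
      (\<Sum>js\<in>?L. if count_list js 1 = m then M (i # js) else 0)"
  proof (cases "m \<le> ?d")
    case True
    have "Poly_Mapping.lookup (Poly_Mapping.single (\<Sum>j\<leftarrow>js. Poly_Mapping.single j 1) (M (i # js))) (?t m)
        = (if count_list js 1 = m then M (i # js) else 0)" if "js \<in> ?L" for js
      using monomial_eq_iff_count_list[of js ?d m] True that
      by (simp only: lookup_single when_def mem_Collect_eq)
    hence "(\<Sum>js\<in>?L. Poly_Mapping.lookup (Poly_Mapping.single (\<Sum>j\<leftarrow>js. Poly_Mapping.single j 1) (M (i # js))) (?t m))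
        = (\<Sum>js\<in>?L. if count_list js 1 = m then M (i # js) else 0)"
      by (intro sum.cong) auto
    thus ?thesis using True by (simp only: form lookup_sum if_True)
  next
    \<comment> \<open>Beyond the formal degree both sides vanish: a list of length \<open>?d\<close>
      cannot contain more than \<open>?d\<close> ones.\<close>
    case False
    hence "(\<Sum>js\<in>?L. if count_list js 1 = m then M (i # js) else 0) = 0"
      using count by (intro sum.neutral) fastforce
    thus ?thesis using False by (simp only: if_False)
  qed
  also have "\<dots> = coeff (\<Sum>js\<in>?L. monom (M (i # js)) (count_list js 1)) m"
    by (simp add: coeff_sum)
  finally show "coeff (dehomogenize ?d (hyper_form k 2 M i)) m =
      coeff (\<Sum>js\<in>?L. monom (M (i # js)) (count_list js 1)) m" .
qed

text \<open>This is the expansion of (1 + X)^d by choices: every position independently contributes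
  X for the index 1 or 1 for the index 2.\<close>

lemma sum_monom_count_list:
  "(\<Sum>js | set js \<subseteq> {1..2::nat} \<and> length js = d. monom (1::'a::comm_semiring_1) (count_list js 1)) = [:1, 1:] ^ d"
proof (induction d)
  case 0
  have "{js. set js \<subseteq> {1..2::nat} \<and> length js = 0} = {[]}" by auto
  thus ?case by (simp add: monom_0 one_pCons)
next
  case (Suc d)
  let ?L = "{js. set js \<subseteq> {1..2::nat} \<and> length js = d}"
  have "(\<Sum>js | set js \<subseteq> {1..2::nat} \<and> length js = Suc d. monom (1::'a) (count_list js 1))
      = (\<Sum>(js, a)\<in>?L \<times> {1..2}. monom 1 (count_list (a # js) 1))"
    unfolding lists_length_Suc_eq by (subst sum.reindex) (auto simp: inj_on_def intro!: sum.cong)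
  also have "\<dots> = (\<Sum>js\<in>?L. \<Sum>a\<in>{1, 2}. monom 1 (count_list (a # js) 1))"
  proof -
    have "{1..2::nat} = {1, 2}" by auto
    thus ?thesis by (simp only: sum.cartesian_product)
  qed
  also have "\<dots> = (\<Sum>js\<in>?L. [:1, 1:] * monom 1 (count_list js 1))"
    by (intro sum.cong) (auto simp: monom_Suc add.commute)
  also have "\<dots> = [:1, 1:] ^ Suc d" by (simp only: sum_distrib_left[symmetric] Suc power_Suc)
  finally show ?case .
qed

section \<open>The Steiner distance hypermatrix of the edge\<close>

lemma steiner_dist_singleton:
  assumes "v \<in> fst G"
  shows "steiner_dist G {v} = 0"
proof -
  have "is_subgraph ({v}, {}) G \<and> connected_graph ({v}, {}) \<and> {v} \<subseteq> fst ({v}, {}::'a set set) \<and>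
      finite (snd ({v}, {}::'a set set)) \<and> card (snd ({v}, {}::'a set set)) = 0"
    using assms by (auto simp: is_subgraph_def is_graph_def connected_graph_def)
  thus ?thesis unfolding steiner_dist_def by (intro Least_eq_0) blast
qed

lemma steiner_dist_K2: "steiner_dist K2 {1, 2} = 1"
  unfolding steiner_dist_def
proof (rule Least_equality)
  have "connected_graph K2"
    by (auto simp: connected_graph_def K2_def insert_commute intro!: r_into_rtrancl)
  thus "\<exists>H. is_subgraph H K2 \<and> connected_graph H \<and> {1, 2} \<subseteq> fst H \<and>
      finite (snd H) \<and> card (snd H) = 1"
    by (intro exI[of _ K2]) (auto simp: is_subgraph_def is_graph_def K2_def)
next
  fix n
  assume "\<exists>H. is_subgraph H K2 \<and> connected_graph H \<and> {1, 2} \<subseteq> fst H \<and>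
      finite (snd H) \<and> card (snd H) = n"
  then obtain H :: "nat graph"
    where H: "connected_graph H" "{1, 2} \<subseteq> fst H" "finite (snd H)" "card (snd H) = n"
    by blast
  have "(1, 2) \<in> {(x, y). {x, y} \<in> snd H}\<^sup>*" using H(1,2) unfolding connected_graph_def by blast
  \<comment> \<open>A walk between distinct vertices has a first step, hence an edge.\<close>
  hence "snd H \<noteq> {}" by (rule converse_rtranclE) auto
  hence "card (snd H) > 0" using H(3) by (simp add: card_gt_0_iff)
  thus "1 \<le> n" using H(4) by simp
qed

lemma steiner_hypermatrix_K2_Cons:
  assumes "i \<in> {1, 2}" and "set js \<subseteq> {1..2}" and "length js = k - 1" and "k > 0"
  shows "steiner_hypermatrix k K2 (i # js) = (if js = replicate (k - 1) i then 0 else 1)"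
proof -
  have sub: "set js \<subseteq> {1, 2}" using assms(2) by fastforce
  have *: "steiner_hypermatrix k K2 (i # js) = of_nat (steiner_dist K2 (set (i # js)))"
    using assms sub by (auto simp: steiner_hypermatrix_def K2_def)
  show ?thesis
  proof (cases "js = replicate (k - 1) i")
    case True
    hence "set (i # js) = {i}" by auto
    moreover have "steiner_dist K2 {i} = 0"
      using assms(1) by (intro steiner_dist_singleton) (auto simp: K2_def)
    ultimately have "steiner_hypermatrix k K2 (i # js) = 0" unfolding * by (simp only: of_nat_0)
    thus ?thesis using True by simp
  next
    case False
    then obtain a where "a \<in> set js" "a \<noteq> i" using assms(3) replicate_eqI[of js "k - 1" i] by blast
    hence "set (i # js) = {1, 2}" using assms(1) sub by auto
    hence "steiner_hypermatrix k K2 (i # js) = 1" unfolding * by (simp only: steiner_dist_K2 of_nat_1)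
    thus ?thesis using False by simp
  qed
qed

text \<open>An all-ones hypermatrix would give (1 + X)^(k-1). The only zero entry with first index
  \<open>i\<close> is the constant one, which removes X^(k-1) for \<open>i = 1\<close> and the
  constant 1 for \<open>i = 2\<close>.\<close>

lemma dehomogenize_steiner_K2:
  assumes "i \<in> {1, 2}" and "k > 0"
  shows "dehomogenize (k - 1) (hyper_form k 2 (steiner_hypermatrix k K2) i) =
           [:1, 1:] ^ (k - 1) - monom 1 (count_list (replicate (k - 1) i) 1)"
proof -
  let ?L = "{js. set js \<subseteq> {1..2::nat} \<and> length js = k - 1}"
  let ?r = "replicate (k - 1) i"
  have fin: "finite ?L" by (rule finite_lists_length_eq) simp
  have r: "?r \<in> ?L" using assms(1) by auto
  have "dehomogenize (k - 1) (hyper_form k 2 (steiner_hypermatrix k K2) i) =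
      (\<Sum>js\<in>?L. monom 1 (count_list js 1) - (if js = ?r then monom 1 (count_list js 1) else 0))"
    unfolding dehomogenize_hyper_form using assms
    by (intro sum.cong) (auto simp: steiner_hypermatrix_K2_Cons)
  also have "\<dots> = [:1, 1:] ^ (k - 1) - monom 1 (count_list ?r 1)"
    using fin r unfolding sum_subtractf sum_monom_count_list by (simp add: sum.delta)
  finally show ?thesis .
qed

section \<open>Evaluation at the roots of unity\<close>

lemma hyperdet2_steiner_K2:
  assumes "k \<ge> 2"
  shows "hyperdet2 k (steiner_hypermatrix k K2) = (-1) ^ (k - 1) * wendt (k - 1)"
proof -
  define d where "d = k - 1"
  have d: "d > 0" using assms by (simp add: d_def)
  define f where "f = [:1, 1:] ^ d - monom (1::complex) d"
  define z where "z l = cis (2 * pi * real l / real d)" for l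
  have bij: "bij_betw z {..<d} {x. x ^ d = 1}"
    unfolding z_def by (rule bij_betw_roots_unity[OF d])
  have deg: "degree f \<le> d"
    unfolding f_def by (intro degree_diff_le degree_monom_le)
      (use degree_power_le[of "[:1, 1::complex:]" d] in auto)
  have z: "z l ^ d = 1" if "l < d" for l using bij that by (auto simp: bij_betw_def)
  have "count_list (replicate d (1::nat)) 1 = d" "count_list (replicate d (2::nat)) 1 = 0"
    by (induction d) auto
  hence "dehomogenize d (hyper_form k 2 (steiner_hypermatrix k K2) 1) = f"
    and "dehomogenize d (hyper_form k 2 (steiner_hypermatrix k K2) 2) = f + monom 1 d - 1"
    using dehomogenize_steiner_K2[of 1 k] dehomogenize_steiner_K2[of 2 k] assms
    unfolding d_def[symmetric] f_def by (simp_all add: monom_0 one_pCons)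
  hence "hyperdet2 k (steiner_hypermatrix k K2) = det (sylvester_mat_sub d d f (f + monom 1 d - 1))"
    unfolding hyperdet2_def binary_resultant_def d_def[symmetric] by (simp only:)
  also have "\<dots> = (-1) ^ d * (\<Prod>l<d. poly f (z l))"
    using bij by (intro det_sylvester_add_roots_of_unity d deg z) (auto simp: bij_betw_def)
  also have "(\<Prod>l<d. poly f (z l)) = wendt d"
    unfolding wendt_def atLeast0LessThan
  proof (rule prod.cong)
    fix l assume "l \<in> {..<d}"
    moreover have "z l = exp (2 * of_real pi * \<i> * of_nat l / of_nat d)"
      by (simp add: z_def cis_conv_exp mult_ac)
    \<comment> \<open>The term z^d in f(z) = (1 + z)^d - z^d equals 1, which produces the factor of
      Wendt's determinant.\<close>
    ultimately show "poly f (z l) = (1 + exp (2 * of_real pi * \<i> * of_nat l / of_nat d)) ^ d - 1"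
      using z[of l] by (simp add: f_def poly_monom)
  qed simp
  finally show ?thesis by (simp add: d_def)
qed

theorem mainTheorem2:
  fixes k :: nat
  assumes "k \<ge> 2"
  shows "hyperdet2 k (steiner_hypermatrix k K2) =
           (-1) ^ (k - 1) *
           (\<Prod>j = 0..k - 2. ((1 + exp (2 * of_real pi * \<i> * of_nat j / of_nat (k - 1))) ^ (k - 1) - 1))
         \<and> (-1) ^ (k - 1) * hyperdet2 k (steiner_hypermatrix k K2) = wendt (k - 1)"
proof -
  \<comment> \<open>With truncated subtraction the two ranges agree only from \<open>k = 2\<close>
    on. The second conjunct then follows because the sign squares to 1.\<close>
  have "{0..k - 2} = {0..<k - 1}" using assms by auto
  thus ?thesis
    by (simp add: hyperdet2_steiner_K2[OF assms] wendt_def flip: power_mult_distrib mult.assoc)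
qed

end
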